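(* Let $g\in SO(8)$. Then $g$ preserves $B$, i.e. $B(g q,g q')=B(q,q')$ for all $q,q'\in\mathbb{O}$, if and only if there exist $a,d\in S^3$ such that $$g=\begin{pmatrix}R_a&0\\0&R_d\end{pmatrix},$$ i.e. $g(x,y)=(xa,yd)$ for all $(x,y)\in\mathbb{H}^2$. Consequently the subgroup of $SO(8)$ preserving $B$ is (isomorphic to) $SU(2)\times SU(2)$.
   Context: $\mathbb{H}$ denotes the quaternions with conjugation $x\mapsto\bar x$, $S^3$ the unit quaternions, and $R_a(x)=xa$ for $a,x\in\mathbb{H}$. The octonions are $\mathbb{O}=\mathbb{H}^2=\mathbb{R}^8$ with its standard Euclidean structure, and $SO(8)$ acts on $\mathbb{O}=\mathbb{R}^8$. For $q=(x,y)$, $q'=(x',y')$ in $\mathbb{O}$, $B(q,q')=x\,\overline{x'}+y'\,\overline{y}\in\mathbb{H}$ (this is the first component of the octonion $q\cdot\overline{q'}$ for the product $(x,y)\cdot(x',y')=(xx'-y'\bar y,\ x'y+\bar x y')$ and the conjugation $\overline{(x,y)}=(\bar x,-y)$). *)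

theory Defs
  imports "HOL-Analysis.Analysis" "HOL-Algebra.Group"
begin

datatype quat = Quat (qRe: real) (qI: real) (qJ: real) (qK: real)

instantiation quat :: ring_1
begin

definition "0 = Quat 0 0 0 0"
definition "1 = Quat 1 0 0 0"
definition "p + q = Quat (qRe p + qRe q) (qI p + qI q) (qJ p + qJ q) (qK p + qK q)"
definition "p - q = Quat (qRe p - qRe q) (qI p - qI q) (qJ p - qJ q) (qK p - qK q)"
definition "- q = Quat (- qRe q) (- qI q) (- qJ q) (- qK q)"
definition "p * q = Quat
  (qRe p * qRe q - qI p * qI q - qJ p * qJ q - qK p * qK q)
  (qRe p * qI q + qI p * qRe q + qJ p * qK q - qK p * qJ q)
  (qRe p * qJ q - qI p * qK q + qJ p * qRe q + qK p * qI q)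
  (qRe p * qK q + qI p * qJ q - qJ p * qI q + qK p * qRe q)"

instance
  by standard
    (simp_all add: zero_quat_def one_quat_def plus_quat_def minus_quat_def
      uminus_quat_def times_quat_def algebra_simps)

end

definition qcnj :: "quat \<Rightarrow> quat" where
  "qcnj q = Quat (qRe q) (- qI q) (- qJ q) (- qK q)"

definition S3 :: "quat set" where
  "S3 = {q. (qRe q)\<^sup>2 + (qI q)\<^sup>2 + (qJ q)\<^sup>2 + (qK q)\<^sup>2 = 1}"

type_synonym oct = "quat \<times> quat"

fun B :: "oct \<Rightarrow> oct \<Rightarrow> quat" where
  "B (x, y) (x', y') = x * qcnj x' + y' * qcnj y"

text \<open>The identification of \<open>\<real>\<^sup>8\<close> with pairs of quaternions. The indices \<open>1, \<dots>, 8\<close> are the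
  elements of the numeral type \<open>8\<close>, in which \<open>8 = 0\<close>.\<close>

definition oct_of_vec :: "real^8 \<Rightarrow> oct" where
  "oct_of_vec v = (Quat (v$1) (v$2) (v$3) (v$4), Quat (v$5) (v$6) (v$7) (v$8))"

fun vec_of_oct :: "oct \<Rightarrow> real^8" where
  "vec_of_oct (x, y) = vector [qRe x, qI x, qJ x, qK x, qRe y, qI y, qJ y, qK y]"

definition oct_action :: "real^8^8 \<Rightarrow> oct \<Rightarrow> oct" where
  "oct_action g q = oct_of_vec (g *v vec_of_oct q)"

definition preserves_B :: "real^8^8 \<Rightarrow> bool" where
  "preserves_B g \<longleftrightarrow> (\<forall>q q'. B (oct_action g q) (oct_action g q') = B q q')"

definition SO :: "(real^'n^'n) monoid" where
  "SO = \<lparr>carrier = {A. rotation_matrix A}, mult = (**), one = mat 1\<rparr>"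

definition SU :: "(complex^'n^'n) monoid" where
  "SU = \<lparr>carrier = {A. map_matrix cnj (transpose A) ** A = mat 1 \<and> det A = 1},
         mult = (**), one = mat 1\<rparr>"

definition SO_B :: "(real^8^8) set" where
  "SO_B = {g \<in> carrier SO. preserves_B g}"

lemma exhaust_8: "x = 1 \<or> x = 2 \<or> x = 3 \<or> x = 4 \<or> x = 5 \<or> x = 6 \<or> x = 7 \<or> x = 8" for x :: 8
proof (induct x)
  case (of_int z)
  then have "z = 0 \<or> z = 1 \<or> z = 2 \<or> z = 3 \<or> z = 4 \<or> z = 5 \<or> z = 6 \<or> z = 7" by fastforce
  then show ?case by auto
qed

lemma UNIV_8: "UNIV = {1, 2, 3, 4, 5, 6, 7, 8 :: 8}"
  using exhaust_8 by auto

lemma vec_of_oct_nth [simp]: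
  "vec_of_oct (x, y) $ 1 = qRe x" "vec_of_oct (x, y) $ 2 = qI x"
  "vec_of_oct (x, y) $ 3 = qJ x" "vec_of_oct (x, y) $ 4 = qK x"
  "vec_of_oct (x, y) $ 5 = qRe y" "vec_of_oct (x, y) $ 6 = qI y"
  "vec_of_oct (x, y) $ 7 = qJ y" "vec_of_oct (x, y) $ 8 = qK y"
  by (simp_all add: vector_def)

lemma oct_of_vec_of_oct [simp]: "oct_of_vec (vec_of_oct q) = q"
  by (cases q) (simp add: oct_of_vec_def del: vec_of_oct.simps)

lemma vec_of_oct_of_vec [simp]: "vec_of_oct (oct_of_vec v) = v"
proof -
  have "vec_of_oct (oct_of_vec v) $ i = v $ i" for i
    using exhaust_8[of i]
    by (elim disjE) (simp_all only: oct_of_vec_def vec_of_oct_nth quat.sel)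
  then show ?thesis by (simp add: vec_eq_iff)
qed

lemma sum_8: "sum f (UNIV :: 8 set) = f 1 + f 2 + f 3 + f 4 + f 5 + f 6 + f 7 + f 8"
  unfolding UNIV_8 by (simp add: ac_simps)

lemma qRe_B: "qRe (B (oct_of_vec v) (oct_of_vec w)) = v \<bullet> w"
  by (simp only: oct_of_vec_def inner_vec_def sum_8 B.simps plus_quat_def times_quat_def
      qcnj_def quat.sel inner_real_def) simp

lemma group_SO: "group (SO :: (real^'n^'n) monoid)"
proof (rule groupI)
  fix A :: "real^'n^'n"
  assume A: "A \<in> carrier SO"
  then have "Finite_Cartesian_Product.transpose A \<in> carrier SO"
    "Finite_Cartesian_Product.transpose A ** A = mat 1"
    by (simp_all add: SO_def rotation_matrix_def orthogonal_matrix_def)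
  then show "\<exists>C\<in>carrier SO. C \<otimes>\<^bsub>SO\<^esub> A = \<one>\<^bsub>SO\<^esub>"
    by (auto simp: SO_def)
qed (simp_all add: SO_def rotation_matrix_def orthogonal_matrix_mul orthogonal_matrix_id det_mul
    matrix_mul_assoc)

end

theory Submission
  imports Defs
begin

text \<open>The real part of \<open>B\<close> is the Euclidean inner product, and its imaginary part is encoded in
  linear operators: for a quaternion \<open>m\<close> put \<open>J m (x, y) = (m x, m' y)\<close>, with \<open>m'\<close> the conjugate of
  \<open>m\<close>. Then \<open>Re (m B(q, q')) = \<langle>J m q, q'\<rangle>\<close> (\<open>qRe_times_B\<close>), so an orthogonal map preserves \<open>B\<close>
  only if it commutes with every \<open>J m\<close> (\<open>preserves_B_commutes_J\<close>).

  The operators \<open>J\<close> do not multiply like the quaternions, since the second component is conjugated: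
  \<open>J i (J j (J k (x, y))) = (- x, y)\<close>. An operator that commutes with all of them hence commutes with
  this reflection and preserves both summands of \<open>\<real>\<^sup>8 = \<H> \<oplus> \<H>\<close>. On each summand
  it commutes with all left multiplications and so is the right multiplication by the image of \<open>1\<close>,
  which is a unit because \<open>B((1, 0), (1, 0)) = 1\<close>, and likewise for \<open>(0, 1)\<close>.

  Conversely, a pair \<open>(R\<^sub>a, R\<^sub>d)\<close> of right multiplications by units visibly preserves \<open>B\<close>, hence is
  orthogonal. Its determinant is \<open>1\<close> because units have square roots in \<open>S\<^sup>3\<close>, so that the map is the
  square of another orthogonal map (\<open>pair_right_mult_in_SO\<close>). Right multiplications compose in the
  opposite order. Inverting, that is, conjugating \<open>a\<close> and \<open>d\<close>, turns this into a homomorphism, and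
  the usual identification of \<open>S\<^sup>3\<close> with \<open>SU(2)\<close> gives the isomorphism. In both directions it is
  polynomial in the coordinates, so it is a homeomorphism.\<close>

section \<open>Quaternion arithmetic\<close>

lemma quat_eq_iff: "p = q \<longleftrightarrow> qRe p = qRe q \<and> qI p = qI q \<and> qJ p = qJ q \<and> qK p = qK q"
  by (cases p; cases q) simp

lemmas quat_ops = zero_quat_def one_quat_def plus_quat_def minus_quat_def uminus_quat_def
  times_quat_def qcnj_def

lemma qcnj_mult: "qcnj (p * q) = qcnj q * qcnj p"
  by (simp add: quat_eq_iff quat_ops algebra_simps)

lemma qcnj_qcnj [simp]: "qcnj (qcnj q) = q"
  by (simp add: quat_eq_iff quat_ops)

lemma qcnj_1 [simp]: "qcnj 1 = 1"
  by (simp add: quat_eq_iff quat_ops)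

lemma qcnj_0 [simp]: "qcnj 0 = 0"
  by (simp add: quat_eq_iff quat_ops)

lemma S3_iff: "a \<in> S3 \<longleftrightarrow> a * qcnj a = 1"
  by (auto simp: S3_def quat_eq_iff quat_ops power2_eq_square algebra_simps)

lemma S3_qcnj: "a \<in> S3 \<Longrightarrow> qcnj a \<in> S3"
  by (simp add: S3_def qcnj_def)

lemma S3_mult_qcnj: "a \<in> S3 \<Longrightarrow> a * qcnj a = 1"
  by (simp add: S3_iff)

lemma S3_qcnj_mult: "a \<in> S3 \<Longrightarrow> qcnj a * a = 1"
  using S3_mult_qcnj[OF S3_qcnj] by simp

lemma S3_mult: "a \<in> S3 \<Longrightarrow> b \<in> S3 \<Longrightarrow> a * b \<in> S3"
  by (simp add: S3_iff qcnj_mult mult.assoc) (metis mult.assoc mult_1)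

lemma S3_1: "1 \<in> S3"
  by (simp add: S3_iff)

text \<open>A square root of a unit \<open>a \<noteq> -1\<close> is the normalization of the midpoint of \<open>1\<close> and \<open>a\<close>.\<close>

lemma S3_square_root:
  assumes "a \<in> S3"
  obtains b where "b \<in> S3" "a = b * b"
proof -
  obtain t u v w where a: "a = Quat t u v w" by (cases a)
  have unit: "t\<^sup>2 + u\<^sup>2 + v\<^sup>2 + w\<^sup>2 = 1"
    using assms by (simp add: S3_def a)
  have "t\<^sup>2 \<le> 1"
    using unit zero_le_power2[of u] zero_le_power2[of v] zero_le_power2[of w] by linarith
  then have "- 1 \<le> t" by (simp add: abs_square_le_1 abs_le_iff)
  show ?thesis
  proof (cases "t = - 1")
    case True
    then have "u\<^sup>2 + v\<^sup>2 + w\<^sup>2 = 0" using unit by simp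
    then have "u = 0" "v = 0" "w = 0"
      by (smt (verit) zero_le_power2 power2_eq_iff zero_power2)+
    then show ?thesis
      using True by (intro that[of "Quat 0 1 0 0"]) (simp_all add: S3_def a quat_ops)
  next
    case False
    define s where "s = sqrt ((1 + t) / 2)"
    have s2: "s\<^sup>2 = (1 + t) / 2" and "s \<noteq> 0"
      using \<open>- 1 \<le> t\<close> False by (simp_all add: s_def)
    then have t: "t = 2 * s\<^sup>2 - 1" by simp
    have vec: "u\<^sup>2 + v\<^sup>2 + w\<^sup>2 = 4 * s\<^sup>2 * (1 - s\<^sup>2)"
      using unit by (simp add: t power2_eq_square algebra_simps)
    have quot: "(u / (2 * s))\<^sup>2 + (v / (2 * s))\<^sup>2 + (w / (2 * s))\<^sup>2 = 1 - s\<^sup>2"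
    proof -
      have "(u / (2 * s))\<^sup>2 + (v / (2 * s))\<^sup>2 + (w / (2 * s))\<^sup>2 = (u\<^sup>2 + v\<^sup>2 + w\<^sup>2) / (4 * s\<^sup>2)"
        by (simp add: power_divide power_mult_distrib add_divide_distrib)
      also have "\<dots> = 1 - s\<^sup>2" using \<open>s \<noteq> 0\<close> by (simp add: vec)
      finally show ?thesis .
    qed
    show ?thesis
    proof (rule that[of "Quat s (u / (2 * s)) (v / (2 * s)) (w / (2 * s))"])
      show "Quat s (u / (2 * s)) (v / (2 * s)) (w / (2 * s)) \<in> S3"
        using quot by (simp add: S3_def)
      show "a = Quat s (u / (2 * s)) (v / (2 * s)) (w / (2 * s)) *
                Quat s (u / (2 * s)) (v / (2 * s)) (w / (2 * s))"
        using quot \<open>s \<noteq> 0\<close> by (simp add: a times_quat_def) (simp add: t power2_eq_square)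
    qed
  qed
qed

section \<open>The form B and the operators J\<close>

fun J :: "quat \<Rightarrow> oct \<Rightarrow> oct" where
  "J m (x, y) = (m * x, qcnj m * y)"

text \<open>The second summand of \<open>B\<close> has \<open>y\<close> conjugated and on the right. Real parts are invariant under
  cyclic permutation, so a factor \<open>m\<close> can be moved next to it, where it is absorbed into \<open>y\<close> as
  its conjugate.\<close>

lemma qRe_times_B: "qRe (m * B q q') = qRe (B (J m q) q')"
  by (cases q; cases q') (simp add: quat_ops algebra_simps)

lemma qRe_B_oct: "qRe (B p q) = vec_of_oct p \<bullet> vec_of_oct q"
  using qRe_B[of "vec_of_oct p" "vec_of_oct q"] by simp

lemma B_nondegenerate:
  assumes "\<And>q. qRe (B p q) = qRe (B p' q)"
  shows "p = p'"
proof -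
  have "vec_of_oct p \<bullet> v = vec_of_oct p' \<bullet> v" for v
    using assms[of "oct_of_vec v"] by (simp add: qRe_B_oct)
  then have "vec_of_oct p = vec_of_oct p'"
    using vector_eq_rdot by blast
  then show ?thesis by (metis oct_of_vec_of_oct)
qed

text \<open>A real \<open>r\<close> is self-conjugate, so that \<open>J r\<close> is the scaling by \<open>r\<close> of \<open>\<real>\<^sup>8\<close>.\<close>

lemma oct_of_vec_scaleR: "oct_of_vec (r *\<^sub>R v) = J (Quat r 0 0 0) (oct_of_vec v)"
  by (simp add: oct_of_vec_def quat_ops)

lemma oct_of_vec_add: "oct_of_vec (v + w) = oct_of_vec v + oct_of_vec w"
  by (simp add: oct_of_vec_def quat_ops)

lemma vec_of_oct_scaleR: "vec_of_oct (J (Quat r 0 0 0) q) = r *\<^sub>R vec_of_oct q"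
  by (metis oct_of_vec_of_oct oct_of_vec_scaleR vec_of_oct_of_vec)

lemma vec_of_oct_add: "vec_of_oct (p + q) = vec_of_oct p + vec_of_oct q"
  by (metis oct_of_vec_of_oct oct_of_vec_add vec_of_oct_of_vec)

section \<open>The action of matrices on pairs of quaternions\<close>

lemma oct_action_add: "oct_action g (p + q) = oct_action g p + oct_action g q"
  by (simp add: oct_action_def vec_of_oct_add oct_of_vec_add matrix_vector_right_distrib)

lemma oct_action_mult: "oct_action (g ** h) q = oct_action g (oct_action h q)"
  by (simp add: oct_action_def matrix_vector_mul_assoc)

lemma oct_action_one: "oct_action (mat 1) q = q"
  by (simp add: oct_action_def)

lemma oct_action_inject:
  assumes "\<And>q. oct_action g q = oct_action h q"
  shows "g = h"
proof -
  have "g *v v = h *v v" for v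
    using assms[of "oct_of_vec v"] unfolding oct_action_def vec_of_oct_of_vec
    by (metis vec_of_oct_of_vec)
  then show ?thesis by (simp add: matrix_eq)
qed

text \<open>Both \<open>g (J m q)\<close> and \<open>J m (g q)\<close> pair with \<open>g p'\<close> to \<open>Re (m B(q, p'))\<close>, and every vector has
  the form \<open>g p'\<close>.\<close>

lemma preserves_B_commutes_J:
  assumes "g \<in> carrier SO" "preserves_B g"
  shows "oct_action g (J m q) = J m (oct_action g q)"
proof (rule B_nondegenerate)
  fix p
  have "g ** transpose g = mat 1"
    using assms(1) by (simp add: SO_def rotation_matrix_def orthogonal_matrix_def)
  then obtain p' where p: "p = oct_action g p'"
    by (metis oct_action_mult oct_action_one)
  have B: "B (oct_action g r) (oct_action g r') = B r r'" for r r'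
    using assms(2) unfolding preserves_B_def by blast
  show "qRe (B (oct_action g (J m q)) p) = qRe (B (J m (oct_action g q)) p)"
    unfolding p by (simp only: B qRe_times_B[symmetric])
qed

lemma preserves_B_imp_right_mults:
  assumes "g \<in> carrier SO" "preserves_B g"
  obtains a d where "a \<in> S3" "d \<in> S3" "\<And>x y. oct_action g (x, y) = (x * a, y * d)"
proof -
  note commutes = preserves_B_commutes_J[OF assms]
  define refl where "refl q = J (Quat 0 1 0 0) (J (Quat 0 0 1 0) (J (Quat 0 0 0 1) q))" for q
  have refl: "refl (x, y) = (- x, y)" for x y
    by (simp add: refl_def quat_ops quat_eq_iff)
  have refl_commutes: "oct_action g (refl q) = refl (oct_action g q)" for q
    by (simp only: refl_def commutes)
  have neg: "J (- 1) (x, y) = (- x, - y)" for x y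
    by (simp add: quat_ops quat_eq_iff)
  have self_neg: "q = 0" if "q = - q" for q :: quat
    using that by (simp add: quat_ops quat_eq_iff)
  \<comment> \<open>The two summands are the eigenspaces of \<open>refl\<close>.\<close>
  have fst_summand: "snd (oct_action g (x, 0)) = 0" for x
  proof (cases "oct_action g (x, 0)")
    case (Pair u v)
    have "refl (oct_action g (x, 0)) = J (- 1) (oct_action g (x, 0))"
      by (simp only: refl_commutes[symmetric] commutes[symmetric] refl neg minus_zero)
    then show ?thesis
      by (simp only: Pair refl neg) (simp add: self_neg)
  qed
  have snd_summand: "fst (oct_action g (0, y)) = 0" for y
  proof (cases "oct_action g (0, y)")
    case (Pair u v)
    have "refl (oct_action g (0, y)) = oct_action g (0, y)"
      by (simp only: refl_commutes[symmetric] refl minus_zero)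
    then show ?thesis
      using self_neg[of u] by (simp only: Pair refl) simp
  qed
  define a where "a = fst (oct_action g (1, 0))"
  define d where "d = snd (oct_action g (0, 1))"
  have a: "oct_action g (1, 0) = (a, 0)"
    using fst_summand[of 1] by (simp add: a_def prod_eq_iff)
  have d: "oct_action g (0, 1) = (0, d)"
    using snd_summand[of 1] by (simp add: d_def prod_eq_iff)
  have "oct_action g (x, 0) = (x * a, 0)" for x
    using commutes[of x "(1, 0)"] by (simp add: a)
  moreover have "oct_action g (0, y) = (0, y * d)" for y
    using commutes[of "qcnj y" "(0, 1)"] by (simp add: d)
  ultimately have act: "oct_action g (x, y) = (x * a, y * d)" for x y
    using oct_action_add[of g "(x, 0)" "(0, y)"] by simp
  have "B (oct_action g q) (oct_action g q) = B q q" for q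
    using assms(2) unfolding preserves_B_def by blast
  from this[of "(1, 0)"] this[of "(0, 1)"] have "a \<in> S3" "d \<in> S3"
    by (simp_all add: a d S3_iff)
  then show ?thesis using act that by blast
qed

lemma right_mults_imp_preserves_B:
  assumes "a \<in> S3" "d \<in> S3" "\<And>x y. oct_action g (x, y) = (x * a, y * d)"
  shows "preserves_B g"
proof -
  have cancel: "x * a * (qcnj a * y) = x * y" "x * d * (qcnj d * y) = x * y" for x y
    using assms(1,2) by (metis S3_mult_qcnj mult.assoc mult_1)+
  then show ?thesis
    by (auto simp: preserves_B_def assms(3) qcnj_mult)
qed

section \<open>Pairs of right multiplications as rotations\<close>

definition pair_right_mult :: "quat \<Rightarrow> quat \<Rightarrow> real^8^8" where
  "pair_right_mult a d =
    matrix (\<lambda>v. vec_of_oct (fst (oct_of_vec v) * a, snd (oct_of_vec v) * d))"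

lemma oct_action_pair_right_mult: "oct_action (pair_right_mult a d) (x, y) = (x * a, y * d)"
proof -
  let ?R = "\<lambda>q. (fst q * a, snd q * d)"
  have "?R (p + q) = ?R p + ?R q" for p q
    by (simp add: distrib_right)
  moreover have "?R (J m q) = J m (?R q)" for m q
    by (cases q) (simp add: mult.assoc)
  ultimately have "linear (\<lambda>v. vec_of_oct (?R (oct_of_vec v)))"
    by (intro linearI) (simp_all only: oct_of_vec_add oct_of_vec_scaleR vec_of_oct_add
        vec_of_oct_scaleR)
  then show ?thesis
    by (simp add: oct_action_def pair_right_mult_def matrix_vector_mul del: vec_of_oct.simps)
qed

lemma pair_right_mult_mult:
  "pair_right_mult a d ** pair_right_mult a' d' = pair_right_mult (a' * a) (d' * d)"
  by (rule oct_action_inject)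
    (auto simp: oct_action_mult oct_action_pair_right_mult mult.assoc)

lemma pair_right_mult_1: "pair_right_mult 1 1 = mat 1"
  by (rule oct_action_inject) (auto simp: oct_action_one oct_action_pair_right_mult)

lemma preserves_B_imp_orthogonal_matrix:
  assumes "preserves_B g"
  shows "orthogonal_matrix g"
proof -
  have "(g *v v) \<bullet> (g *v w) = v \<bullet> w" for v w
    using assms unfolding preserves_B_def oct_action_def
    by (metis qRe_B vec_of_oct_of_vec)
  then have "orthogonal_transformation ((*v) g)"
    by (simp add: orthogonal_transformation_def)
  then show ?thesis
    by (simp add: orthogonal_transformation_matrix)
qed

lemma pair_right_mult_in_SO:
  assumes "a \<in> S3" "d \<in> S3"
  shows "pair_right_mult a d \<in> carrier SO"
proof -
  have orth: "orthogonal_matrix (pair_right_mult p q)" if "p \<in> S3" "q \<in> S3" for p q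
    using that oct_action_pair_right_mult
    by (intro preserves_B_imp_orthogonal_matrix right_mults_imp_preserves_B)
  obtain p q where pq: "p \<in> S3" "a = p * p" "q \<in> S3" "d = q * q"
    using assms S3_square_root by metis
  have "det (pair_right_mult a d) = det (pair_right_mult p q) * det (pair_right_mult p q)"
    by (simp add: pq(2,4) det_mul flip: pair_right_mult_mult)
  also have "\<dots> = 1"
    using det_orthogonal_matrix[OF orth[OF pq(1,3)]] by auto
  finally show ?thesis
    using orth[OF assms] by (simp add: SO_def rotation_matrix_def)
qed

lemma SO_B_eq: "SO_B = {pair_right_mult a d | a d. a \<in> S3 \<and> d \<in> S3}"
proof (intro equalityI subsetI)
  fix g assume "g \<in> SO_B"
  then obtain a d where "a \<in> S3" "d \<in> S3" "\<And>x y. oct_action g (x, y) = (x * a, y * d)"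
    using preserves_B_imp_right_mults unfolding SO_B_def by blast
  moreover from this have "g = pair_right_mult a d"
    by (intro oct_action_inject) (auto simp: oct_action_pair_right_mult)
  ultimately show "g \<in> {pair_right_mult a d | a d. a \<in> S3 \<and> d \<in> S3}" by blast
next
  fix g assume "g \<in> {pair_right_mult a d | a d. a \<in> S3 \<and> d \<in> S3}"
  then show "g \<in> SO_B"
    using right_mults_imp_preserves_B oct_action_pair_right_mult pair_right_mult_in_SO
    unfolding SO_B_def by blast
qed

lemma subgroup_SO_B: "subgroup SO_B SO"
proof (rule group.subgroupI[OF group_SO])
  show "SO_B \<subseteq> carrier SO" "SO_B \<noteq> {}"
    using S3_1 by (auto simp: SO_B_def[symmetric] SO_B_eq pair_right_mult_in_SO)
  fix g assume "g \<in> SO_B"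
  then obtain a d where g: "g = pair_right_mult a d" "a \<in> S3" "d \<in> S3"
    by (auto simp: SO_B_eq)
  have "inv\<^bsub>SO\<^esub> g = pair_right_mult (qcnj a) (qcnj d)"
    using g by (intro group.inv_equality[OF group_SO])
      (simp_all add: pair_right_mult_in_SO S3_qcnj,
        simp add: SO_def pair_right_mult_mult S3_mult_qcnj pair_right_mult_1)
  then show "inv\<^bsub>SO\<^esub> g \<in> SO_B"
    using g unfolding SO_B_eq by (blast intro: S3_qcnj)
  fix h assume "h \<in> SO_B"
  then obtain b e where h: "h = pair_right_mult b e" "b \<in> S3" "e \<in> S3"
    by (auto simp: SO_B_eq)
  then have "g \<otimes>\<^bsub>SO\<^esub> h = pair_right_mult (b * a) (e * d)"
    using g by (simp add: SO_def pair_right_mult_mult)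
  then show "g \<otimes>\<^bsub>SO\<^esub> h \<in> SO_B"
    using g h unfolding SO_B_eq by (blast intro: S3_mult)
qed

section \<open>Unit quaternions and SU(2)\<close>

text \<open>Right multiplication by \<open>q\<close> is linear for left scalars, and in the complex basis \<open>1, j\<close> it is
  this matrix acting on row vectors: the rows are the coordinates of \<open>q\<close> and of \<open>j q\<close>. Row vectors
  make the map multiplicative rather than order-reversing.\<close>

definition su2_of_quat :: "quat \<Rightarrow> complex^2^2" where
  "su2_of_quat q = vector [vector [Complex (qRe q) (qI q), Complex (qJ q) (qK q)],
                           vector [Complex (- qJ q) (qK q), Complex (qRe q) (- qI q)]]"

definition quat_of_su2 :: "complex^2^2 \<Rightarrow> quat" where
  "quat_of_su2 A = Quat (Re (A$1$1)) (Im (A$1$1)) (Re (A$1$2)) (Im (A$1$2))"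

lemma quat_of_su2_of_quat [simp]: "quat_of_su2 (su2_of_quat q) = q"
  by (simp add: su2_of_quat_def quat_of_su2_def)

lemma su2_of_quat_mult: "su2_of_quat (p * q) = su2_of_quat p ** su2_of_quat q"
  by (simp add: su2_of_quat_def matrix_matrix_mult_def vec_eq_iff forall_2 sum_2 times_quat_def
      complex_eq_iff algebra_simps)

lemma carrier_SU2_iff:
  "A \<in> carrier (SU :: (complex^2^2) monoid) \<longleftrightarrow>
    cnj (A$1$1) * A$1$1 + cnj (A$2$1) * A$2$1 = 1 \<and> cnj (A$1$1) * A$1$2 + cnj (A$2$1) * A$2$2 = 0 \<and>
    cnj (A$1$2) * A$1$1 + cnj (A$2$2) * A$2$1 = 0 \<and> cnj (A$1$2) * A$1$2 + cnj (A$2$2) * A$2$2 = 1 \<and>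
    A$1$1 * A$2$2 - A$1$2 * A$2$1 = 1"
  by (auto simp: SU_def map_matrix_def transpose_def matrix_matrix_mult_def mat_def vec_eq_iff
      forall_2 sum_2 det_2)

lemma su2_of_quat_in_SU: "q \<in> S3 \<Longrightarrow> su2_of_quat q \<in> carrier SU"
  by (simp add: carrier_SU2_iff su2_of_quat_def S3_def complex_eq_iff power2_eq_square
      algebra_simps)

text \<open>For \<open>A\<close> in \<open>SU(2)\<close> the adjoint and the adjugate both invert \<open>A\<close>; comparing them shows that
  the second row is determined by the first.\<close>

lemma SU2_imp_quat:
  assumes "A \<in> carrier (SU :: (complex^2^2) monoid)"
  shows "quat_of_su2 A \<in> S3" "su2_of_quat (quat_of_su2 A) = A"
proof -
  define a b c d where defs: "a = A$1$1" "b = A$1$2" "c = A$2$1" "d = A$2$2"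
  have eqs: "cnj a * a + cnj c * c = 1" "cnj a * b + cnj c * d = 0" "a * d - b * c = 1"
    using assms by (simp_all add: carrier_SU2_iff defs)
  have "d - cnj a = d * (1 - (cnj a * a + cnj c * c)) + cnj a * (a * d - b * c - 1)
      + c * (cnj a * b + cnj c * d)"
    by (simp add: algebra_simps)
  then have d: "d = cnj a" by (simp add: eqs)
  have "b + cnj c = b * (1 - (cnj a * a + cnj c * c)) - cnj c * (a * d - b * c - 1)
      + a * (cnj a * b + cnj c * d)"
    by (simp add: algebra_simps)
  then have "b = - cnj c" by (simp add: eqs add_eq_0_iff2)
  then have c: "c = - cnj b" by simp
  show "quat_of_su2 A \<in> S3"
    using eqs(1) by (simp add: c quat_of_su2_def S3_def complex_eq_iff power2_eq_square
        flip: defs)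
  show "su2_of_quat (quat_of_su2 A) = A"
    using c d by (simp add: su2_of_quat_def quat_of_su2_def vec_eq_iff forall_2 complex_eq_iff
        flip: defs)
qed

section \<open>Continuity\<close>

text \<open>The quaternions carry no topology of their own, so continuity is stated for their
  coordinates.\<close>

definition quat_continuous_on :: "'a::topological_space set \<Rightarrow> ('a \<Rightarrow> quat) \<Rightarrow> bool" where
  "quat_continuous_on S f \<longleftrightarrow>
    continuous_on S (\<lambda>x. qRe (f x)) \<and> continuous_on S (\<lambda>x. qI (f x)) \<and>
    continuous_on S (\<lambda>x. qJ (f x)) \<and> continuous_on S (\<lambda>x. qK (f x))"

lemma quat_continuous_on_qcnj:
  "quat_continuous_on S f \<Longrightarrow> quat_continuous_on S (\<lambda>x. qcnj (f x))"
  by (auto simp: quat_continuous_on_def qcnj_def intro!: continuous_intros)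

lemma quat_continuous_on_mult:
  "quat_continuous_on S f \<Longrightarrow> quat_continuous_on S g \<Longrightarrow> quat_continuous_on S (\<lambda>x. f x * g x)"
  by (auto simp: quat_continuous_on_def times_quat_def intro!: continuous_intros)

lemma quat_continuous_on_oct_action:
  "quat_continuous_on S (\<lambda>g. fst (oct_action g q))"
  "quat_continuous_on S (\<lambda>g. snd (oct_action g q))"
  by (auto simp: quat_continuous_on_def oct_action_def oct_of_vec_def matrix_vector_mult_def
      intro!: continuous_intros)

lemma quat_continuous_on_quat_of_su2:
  assumes "continuous_on S f"
  shows "quat_continuous_on S (\<lambda>x. quat_of_su2 (f x))"
  using assms by (auto simp: quat_continuous_on_def quat_of_su2_def intro!: continuous_intros)

lemma continuous_on_vec_2:
  fixes f :: "'a::topological_space \<Rightarrow> ('b::topological_space)^2"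
  assumes "continuous_on S (\<lambda>x. f x $ 1)" "continuous_on S (\<lambda>x. f x $ 2)"
  shows "continuous_on S f"
proof -
  have "continuous_on S (\<lambda>x. f x $ i)" for i
    using assms exhaust_2[of i] by auto
  then have "continuous_on S (\<lambda>x. \<chi> i. f x $ i)" by (rule continuous_on_vec_lambda)
  then show ?thesis by simp
qed

lemma continuous_on_su2_of_quat:
  assumes "quat_continuous_on S f"
  shows "continuous_on S (\<lambda>x. su2_of_quat (f x))"
  using assms unfolding quat_continuous_on_def su2_of_quat_def
  by (intro continuous_on_vec_2) (auto intro!: continuous_intros)

lemma continuous_on_vec_of_oct:
  assumes "quat_continuous_on S f" "quat_continuous_on S g"
  shows "continuous_on S (\<lambda>x. vec_of_oct (f x, g x))"
proof -
  have "continuous_on S (\<lambda>x. vec_of_oct (f x, g x) $ i)" for i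
    using exhaust_8[of i] assms unfolding quat_continuous_on_def
    by (elim disjE) (simp_all del: vec_of_oct.simps)
  then have "continuous_on S (\<lambda>x. \<chi> i. vec_of_oct (f x, g x) $ i)"
    by (rule continuous_on_vec_lambda)
  then show ?thesis by (simp del: vec_of_oct.simps)
qed

lemma continuous_on_pair_right_mult:
  assumes "quat_continuous_on S f" "quat_continuous_on S g"
  shows "continuous_on S (\<lambda>x. pair_right_mult (f x) (g x))"
proof -
  have const: "quat_continuous_on S (\<lambda>x. p)" for p
    by (simp add: quat_continuous_on_def)
  show ?thesis
    unfolding pair_right_mult_def matrix_def
    by (intro continuous_on_vec_lambda continuous_on_component continuous_on_vec_of_oct
        quat_continuous_on_mult const assms)
qed

section \<open>The stabilizer of B\<close>

text \<open>Right multiplications reverse products, which the conjugation makes up for.\<close>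

definition SO_B_to_SU2s :: "real^8^8 \<Rightarrow> (complex^2^2) \<times> (complex^2^2)" where
  "SO_B_to_SU2s g = (su2_of_quat (qcnj (fst (oct_action g (1, 1)))),
                     su2_of_quat (qcnj (snd (oct_action g (1, 1)))))"

definition SU2s_to_SO_B :: "(complex^2^2) \<times> (complex^2^2) \<Rightarrow> real^8^8" where
  "SU2s_to_SO_B p =
    pair_right_mult (qcnj (quat_of_su2 (fst p))) (qcnj (quat_of_su2 (snd p)))"

lemma SO_B_to_SU2s_pair_right_mult:
  "SO_B_to_SU2s (pair_right_mult a d) = (su2_of_quat (qcnj a), su2_of_quat (qcnj d))"
  by (simp add: SO_B_to_SU2s_def oct_action_pair_right_mult)

lemma SO_B_homeomorphism:
  "homeomorphism SO_B
    (carrier ((SU :: (complex^2^2) monoid) \<times>\<times> (SU :: (complex^2^2) monoid)))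
    SO_B_to_SU2s SU2s_to_SO_B"
proof (rule homeomorphismI)
  show "continuous_on SO_B SO_B_to_SU2s"
    unfolding SO_B_to_SU2s_def
    by (intro continuous_on_Pair continuous_on_su2_of_quat quat_continuous_on_qcnj
        quat_continuous_on_oct_action)
  show "continuous_on (carrier (SU \<times>\<times> SU)) SU2s_to_SO_B"
    unfolding SU2s_to_SO_B_def
    by (intro continuous_on_pair_right_mult quat_continuous_on_qcnj quat_continuous_on_quat_of_su2
        continuous_intros)
  show "SO_B_to_SU2s ` SO_B \<subseteq> carrier (SU \<times>\<times> SU)"
    by (auto simp: SO_B_eq SO_B_to_SU2s_pair_right_mult DirProd_def su2_of_quat_in_SU S3_qcnj)
  show "SU2s_to_SO_B ` carrier (SU \<times>\<times> SU) \<subseteq> SO_B"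
    unfolding SO_B_eq SU2s_to_SO_B_def DirProd_def by (fastforce intro: S3_qcnj SU2_imp_quat(1))
  show "SU2s_to_SO_B (SO_B_to_SU2s g) = g" if "g \<in> SO_B" for g
    using that by (auto simp: SO_B_eq SO_B_to_SU2s_pair_right_mult SU2s_to_SO_B_def)
  show "SO_B_to_SU2s (SU2s_to_SO_B p) = p" if "p \<in> carrier (SU \<times>\<times> SU)" for p
    using that
    by (auto simp: SO_B_to_SU2s_pair_right_mult SU2s_to_SO_B_def DirProd_def SU2_imp_quat)
qed

lemma SO_B_iso:
  "SO_B_to_SU2s \<in>
    iso (SO\<lparr>carrier := SO_B\<rparr>) ((SU :: (complex^2^2) monoid) \<times>\<times> (SU :: (complex^2^2) monoid))"
proof -
  have bij: "bij_betw SO_B_to_SU2s SO_B (carrier (SU \<times>\<times> SU))"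
    using SO_B_homeomorphism unfolding homeomorphism_def by (metis bij_betw_byWitness order_refl)
  have "SO_B_to_SU2s (g ** h) = SO_B_to_SU2s g \<otimes>\<^bsub>SU \<times>\<times> SU\<^esub> SO_B_to_SU2s h"
    if "g \<in> SO_B" "h \<in> SO_B" for g h
    using that by (auto simp: SO_B_eq pair_right_mult_mult SO_B_to_SU2s_pair_right_mult qcnj_mult
        su2_of_quat_mult DirProd_def SU_def)
  then have "SO_B_to_SU2s \<in> hom (SO\<lparr>carrier := SO_B\<rparr>) (SU \<times>\<times> SU)"
    using bij_betwE[OF bij] by (auto simp: hom_def SO_def)
  then show ?thesis
    using bij by (simp add: iso_def)
qed

theorem mainTheorem1:
  shows "(\<forall>g \<in> carrier SO.
            preserves_B g \<longleftrightarrow> (\<exists>a\<in>S3. \<exists>d\<in>S3. \<forall>x y. oct_action g (x, y) = (x * a, y * d)))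
       \<and> subgroup SO_B SO
       \<and> (\<exists>\<phi> \<psi>. \<phi> \<in> iso (SO\<lparr>carrier := SO_B\<rparr>) ((SU :: (complex^2^2) monoid) \<times>\<times> (SU :: (complex^2^2) monoid))
            \<and> homeomorphism SO_B (carrier ((SU :: (complex^2^2) monoid) \<times>\<times> (SU :: (complex^2^2) monoid))) \<phi> \<psi>)"
proof (intro conjI ballI)
  fix g :: "real^8^8" assume "g \<in> carrier SO"
  then show "preserves_B g \<longleftrightarrow> (\<exists>a\<in>S3. \<exists>d\<in>S3. \<forall>x y. oct_action g (x, y) = (x * a, y * d))"
    using preserves_B_imp_right_mults right_mults_imp_preserves_B by metis
qed (use subgroup_SO_B SO_B_iso SO_B_homeomorphism in blast)+

end
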